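(* Let $n\in\mathbb{N}$, $0<\rho<\infty$, and let $\omega$ be a weight on $\mathbb{R}^n$. Then $\omega\in A_{1;\rho}^{\rm loc}$ if and only if there exists a constant $C>0$ such that $$\mathbf{M}_{\rho}^{\rm loc}\omega(x)\le C\,\omega(x)\quad\text{for almost every }x\in\mathbb{R}^n .$$ Moreover, in this case the infimum of all constants $C>0$ for which this holds equals $[\omega]_{A_{1;\rho}^{\rm loc}}$.
   Context: A weight is a locally integrable function $\omega\ge 0$ on $\mathbb{R}^n$ with $\omega(x)>0$ almost everywhere. Cubes $Q$ are open with sides parallel to the axes, and $\ell(Q)$ is the side length. $[\omega]_{A_{1;\rho}^{\rm loc}}=\sup_{\ell(Q)\le\rho}\left(\frac{1}{|Q|}\int_Q\omega\,dx\right)\|\omega^{-1}\|_{L^\infty(Q)}$, the supremum being over all cubes with $\ell(Q)\le\rho$; $A_{1;\rho}^{\rm loc}$ is the set of weights for which this is finite. The uncentered local maximal function is $\mathbf{M}_{\rho}^{\rm loc}f(x)=\sup\left\{\frac{1}{|Q|}\int_Q|f(y)|\,dy:\ x\in Q,\ \ell(Q)\le\rho\right\}$. *)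

theory Defs
  imports "HOL-Analysis.Analysis" "HOL-Probability.Essential_Supremum"
begin

definition locally_integrable :: "(real ^ 'n \<Rightarrow> real) \<Rightarrow> bool" where
  "locally_integrable f \<longleftrightarrow> (\<forall>K. compact K \<longrightarrow> f absolutely_integrable_on K)"

definition weight :: "(real ^ 'n \<Rightarrow> real) \<Rightarrow> bool" where
  "weight \<omega> \<longleftrightarrow> locally_integrable \<omega> \<and> (\<forall>x. 0 \<le> \<omega> x) \<and> (AE x in lebesgue. 0 < \<omega> x)"

definition cube :: "real ^ 'n \<Rightarrow> real \<Rightarrow> (real ^ 'n) set" where
  "cube a l = box a (a + vec l)"

definition cubes_upto :: "real \<Rightarrow> (real ^ 'n) set set" where
  "cubes_upto \<rho> = {cube a l | a l. 0 < l \<and> l \<le> \<rho>}"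

text \<open>Averages, norms and suprema are taken in \<^typ>\<open>ennreal\<close>, so that they may be infinite.\<close>

definition average :: "(real ^ 'n) set \<Rightarrow> (real ^ 'n \<Rightarrow> ennreal) \<Rightarrow> ennreal" where
  "average Q f = (\<integral>\<^sup>+y\<in>Q. f y \<partial>lebesgue) / emeasure lebesgue Q"

definition Linfty_norm :: "(real ^ 'n) set \<Rightarrow> (real ^ 'n \<Rightarrow> real) \<Rightarrow> ennreal" where
  "Linfty_norm Q f = esssup (restrict_space lebesgue Q) (\<lambda>x. ennreal \<bar>f x\<bar>)"

text \<open>The convention \<open>inverse 0 = 0\<close> is harmless below: a weight vanishes only on a null set,
  which the essential supremum ignores.\<close>

definition A1_loc_const :: "real \<Rightarrow> (real ^ 'n \<Rightarrow> real) \<Rightarrow> ennreal" where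
  "A1_loc_const \<rho> \<omega> =
     (SUP Q\<in>cubes_upto \<rho>. average Q (\<lambda>y. ennreal (\<omega> y)) * Linfty_norm Q (\<lambda>x. inverse (\<omega> x)))"

definition A1_loc :: "real \<Rightarrow> (real ^ 'n \<Rightarrow> real) set" where
  "A1_loc \<rho> = {\<omega>. weight \<omega> \<and> A1_loc_const \<rho> \<omega> < \<infinity>}"

definition maximal_loc :: "real \<Rightarrow> (real ^ 'n \<Rightarrow> real) \<Rightarrow> real ^ 'n \<Rightarrow> ennreal" where
  "maximal_loc \<rho> f x = (SUP Q\<in>{Q \<in> cubes_upto \<rho>. x \<in> Q}. average Q (\<lambda>y. ennreal \<bar>f y\<bar>))"

end

theory Submission
  imports Defs
begin

text \<open>For a fixed cube \<open>Q\<close>, a bound \<open>C\<close> on the average of \<open>\<omega>\<close> times the norm of \<open>1 / \<omega>\<close>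
  amounts to \<open>average Q \<omega> \<le> C * \<omega> x\<close> for almost every \<open>x\<close> in \<open>Q\<close>. The null set depends
  on \<open>Q\<close>, and there are uncountably many cubes. But for each \<open>t\<close> in a countable dense set, by Lindelof's theorem,
  countably many of the open cubes with average above \<open>t\<close> cover the union of all of them,
  that is, the set where the maximal function exceeds \<open>t\<close>. So countably many null sets
  suffice, and the admissible constants \<open>C > 0\<close> are exactly those above the \<open>A1\<close> constant.\<close>

text \<open>Local integrability gives measurability on each closed ball, and \<open>\<omega>\<close>
  is the pointwise limit of its truncations to balls of growing radius.\<close>

lemma weight_borel_measurable:
  fixes \<omega> :: "real ^ 'n \<Rightarrow> real"
  assumes "weight \<omega>"
  shows "\<omega> \<in> borel_measurable lebesgue"
proof -
  have m: "(\<lambda>x. indicator (cball 0 (real k)) x *\<^sub>R \<omega> x) \<in> borel_measurable lebesgue" for k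
  proof -
    have "\<omega> absolutely_integrable_on cball 0 (real k)"
      using assms by (simp add: weight_def locally_integrable_def)
    then show ?thesis
      unfolding set_integrable_def by (rule borel_measurable_integrable)
  qed
  show ?thesis
  proof (rule borel_measurable_LIMSEQ_real[OF _ m])
    fix x :: "real ^ 'n"
    obtain N where N: "norm x \<le> real N"
      using real_arch_simple by blast
    show "(\<lambda>k. indicator (cball 0 (real k)) x *\<^sub>R \<omega> x) \<longlonglongrightarrow> \<omega> x"
      by (rule tendsto_eventually, rule eventually_sequentiallyI[of N]) (use N in auto)
  qed
qed

lemma open_cubes_upto: "Q \<in> cubes_upto \<rho> \<Longrightarrow> open Q"
  by (auto simp: cubes_upto_def cube_def)

text \<open>Since \<open>\<omega>\<close> is positive almost everywhere, the pointwise bound can be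
  rewritten as a bound of its inverse by \<open>C / a\<close>, which passes to the essential
  supremum. The extreme values \<open>0\<close> and \<open>top\<close> of \<open>a\<close> need
  separate care.\<close>

lemma average_times_Linfty_norm_inverse_le_iff:
  fixes \<omega> :: "real ^ 'n \<Rightarrow> real"
  assumes \<omega>: "weight \<omega>" and Q: "Q \<in> sets lebesgue" and C: "0 < C"
  shows "a * Linfty_norm Q (\<lambda>x. inverse (\<omega> x)) \<le> ennreal C
    \<longleftrightarrow> (AE x in lebesgue. x \<in> Q \<longrightarrow> a \<le> ennreal (C * \<omega> x))"
proof
  have pos: "AE x in lebesgue. 0 < \<omega> x"
    using \<omega> by (simp add: weight_def)
  let ?S = "restrict_space lebesgue Q"
  have [measurable]: "\<omega> \<in> borel_measurable lebesgue"
    by (rule weight_borel_measurable[OF \<omega>])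
  \<comment> \<open>An essential supremum is \<open>top\<close> by convention when the function is
    not measurable, so bounding it from above requires this.\<close>
  have meas: "(\<lambda>x. ennreal \<bar>inverse (\<omega> x)\<bar>) \<in> borel_measurable ?S"
    by (rule measurable_restrict_space1) measurable
  have AE_S: "(AE x in ?S. P x) \<longleftrightarrow> (AE x in lebesgue. x \<in> Q \<longrightarrow> P x)" for P
    using Q by (subst AE_restrict_space_iff) auto
  {
    assume le: "a * Linfty_norm Q (\<lambda>x. inverse (\<omega> x)) \<le> ennreal C"
    have "AE x in ?S. ennreal \<bar>inverse (\<omega> x)\<bar> \<le> Linfty_norm Q (\<lambda>x. inverse (\<omega> x))"
      unfolding Linfty_norm_def by (rule esssup_AE)
    then show "AE x in lebesgue. x \<in> Q \<longrightarrow> a \<le> ennreal (C * \<omega> x)"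
      unfolding AE_S using pos
    proof eventually_elim
      case (elim x)
      show ?case
      proof
        assume "x \<in> Q"
        then have "a * ennreal (inverse (\<omega> x)) \<le> ennreal C"
          using elim le by (auto intro: order_trans[OF mult_left_mono])
        then have "a * ennreal (inverse (\<omega> x)) * ennreal (\<omega> x) \<le> ennreal C * ennreal (\<omega> x)"
          by (rule mult_right_mono) simp
        moreover have "ennreal (inverse (\<omega> x)) * ennreal (\<omega> x) = 1"
          using elim by (simp flip: ennreal_mult)
        ultimately show "a \<le> ennreal (C * \<omega> x)"
          using elim C by (simp add: mult.assoc ennreal_mult)
      qed
    qed
  next
    assume "AE x in lebesgue. x \<in> Q \<longrightarrow> a \<le> ennreal (C * \<omega> x)"
    then have "AE x in ?S. ennreal \<bar>inverse (\<omega> x)\<bar> \<le> ennreal C / a"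
      unfolding AE_S using pos
    proof eventually_elim
      case (elim x)
      show ?case
      proof
        assume "x \<in> Q"
        with elim have le: "a \<le> ennreal (C * \<omega> x)" by blast
        then have "a \<noteq> top" by (metis ennreal_less_top not_le top.not_eq_extremum)
        show "ennreal \<bar>inverse (\<omega> x)\<bar> \<le> ennreal C / a"
        proof (cases "a = 0")
          case True
          \<comment> \<open>Here \<open>C / 0 = top\<close> because \<open>C\<close> is nonzero, so
            the bound is trivial.\<close>
          then show ?thesis using C by (simp add: ennreal_divide_zero)
        next
          case False
          with \<open>a \<noteq> top\<close> obtain r where r: "a = ennreal r" "0 < r"
            by (cases a) (auto simp: less_le)
          then have "r \<le> C * \<omega> x"
            using le C elim by (simp add: ennreal_le_iff)
          then show ?thesis
            using r C elim by (simp add: divide_ennreal ennreal_le_iff field_simps)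
        qed
      qed
    qed
    then have "Linfty_norm Q (\<lambda>x. inverse (\<omega> x)) \<le> ennreal C / a"
      unfolding Linfty_norm_def by (rule esssup_I[OF meas])
    then have "a * Linfty_norm Q (\<lambda>x. inverse (\<omega> x)) \<le> a * (ennreal C / a)"
      by (rule mult_left_mono) simp
    also have "\<dots> \<le> ennreal C"
    \<comment> \<open>Cancellation fails only at these two values, where \<open>0 * top = 0\<close>
      and \<open>C / top = 0\<close> make the product zero.\<close>
    proof (cases "a = 0 \<or> a = top")
      case False
      then show ?thesis
        by (simp add: ennreal_times_divide mult.commute[of a] ennreal_mult_divide_eq)
    qed auto
    finally show "a * Linfty_norm Q (\<lambda>x. inverse (\<omega> x)) \<le> ennreal C" .
  }
qed

text \<open>This isolates the exchange of "for every \<open>Q\<close>" with "for almost every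
  \<open>x\<close>". A set with value above \<open>t\<close> may be traded for another one through
  the same point: only the level \<open>t\<close> has to survive, not the value itself.\<close>

lemma AE_SUP_open_cover_le:
  fixes \<Q> :: "'a::{second_countable_topology} set set"
    and avg :: "'a set \<Rightarrow> ennreal" and g :: "'a \<Rightarrow> ennreal"
  assumes "\<And>Q. Q \<in> \<Q> \<Longrightarrow> open Q"
    and AE: "\<And>Q. Q \<in> \<Q> \<Longrightarrow> AE x in M. x \<in> Q \<longrightarrow> avg Q \<le> g x"
  shows "AE x in M. (SUP Q\<in>{Q \<in> \<Q>. x \<in> Q}. avg Q) \<le> g x"
proof -
  obtain D :: "ennreal set" where D: "countable D"
      "\<And>X. open X \<Longrightarrow> X \<noteq> {} \<Longrightarrow> \<exists>d\<in>D. d \<in> X"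
    by (rule countable_dense_setE) (rule that)
  have dense_D: "\<exists>t\<in>D. a < t \<and> t < b" if "a < b" for a b
  proof -
    have "{a<..<b} \<noteq> {}"
      using dense[OF that] by auto
    then show ?thesis
      using D(2)[OF open_greaterThanLessThan] by auto
  qed
  have "\<exists>F. F \<subseteq> {Q \<in> \<Q>. t < avg Q} \<and> countable F \<and> \<Union>F = \<Union>{Q \<in> \<Q>. t < avg Q}" for t
  proof -
    have "open Q" if "Q \<in> {Q \<in> \<Q>. t < avg Q}" for Q
      using that assms(1) by simp
    then show ?thesis
      by (rule Lindelof[of "{Q \<in> \<Q>. t < avg Q}"]) (assumption, intro exI conjI)
  qed
  then have "\<exists>F. \<forall>t. F t \<subseteq> {Q \<in> \<Q>. t < avg Q} \<and> countable (F t) \<and> \<Union>(F t) = \<Union>{Q \<in> \<Q>. t < avg Q}"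
    by (intro choice allI)
  then obtain F where "\<forall>t. F t \<subseteq> {Q \<in> \<Q>. t < avg Q} \<and> countable (F t) \<and>
      \<Union>(F t) = \<Union>{Q \<in> \<Q>. t < avg Q}" ..
  then have F: "\<And>t. F t \<subseteq> {Q \<in> \<Q>. t < avg Q}" "\<And>t. countable (F t)"
      "\<And>t. \<Union>(F t) = \<Union>{Q \<in> \<Q>. t < avg Q}"
    by simp_all
  \<comment> \<open>Both \<open>D\<close> and each \<open>F t\<close> are countable, so the
    exceptional sets unite to a null set.\<close>
  have "AE x in M. \<forall>t\<in>D. \<forall>Q\<in>F t. x \<in> Q \<longrightarrow> avg Q \<le> g x"
  proof (intro AE_ball_countable[THEN iffD2] ballI D(1) F(2))
    show "AE x in M. x \<in> Q \<longrightarrow> avg Q \<le> g x" if "Q \<in> F t" for t Q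
      using that F(1) by (blast intro: AE)
  qed
  then show ?thesis
  proof eventually_elim
    case (elim x)
    show ?case
    proof (rule ccontr)
      assume "\<not> ?thesis"
      then have "g x < (SUP Q\<in>{Q \<in> \<Q>. x \<in> Q}. avg Q)"
        by (simp only: not_le)
      \<comment> \<open>With \<open>t\<close> strictly in between, the member of \<open>F t\<close>
        found through \<open>x\<close> gives \<open>t < avg Q \<le> g x < t\<close>.\<close>
      from dense_D[OF this] obtain t where t: "t \<in> D" "g x < t" "t < (SUP Q\<in>{Q \<in> \<Q>. x \<in> Q}. avg Q)"
        by blast
      then have "x \<in> \<Union>{Q \<in> \<Q>. t < avg Q}"
        by (auto simp: less_SUP_iff)
      then obtain Q where "Q \<in> F t" "x \<in> Q"
        using F(3) by blast
      then have "t < avg Q" "avg Q \<le> g x"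
        using F(1) elim t(1) by blast+
      with t(2) show False by simp
    qed
  qed
qed

text \<open>Both sides reduce to one almost-everywhere bound per cube. Passing from these to the
  maximal function needs the covering lemma; the converse just picks one cube from the
  supremum.\<close>

lemma AE_maximal_loc_le_iff:
  fixes \<omega> :: "real ^ 'n \<Rightarrow> real"
  assumes \<omega>: "weight \<omega>" and C: "0 < C"
  shows "(AE x in lebesgue. maximal_loc \<rho> \<omega> x \<le> ennreal (C * \<omega> x))
    \<longleftrightarrow> A1_loc_const \<rho> \<omega> \<le> ennreal C"
proof -
  have sets: "Q \<in> sets lebesgue" if "Q \<in> cubes_upto \<rho>" for Q :: "(real ^ 'n) set"
    using open_cubes_upto[OF that] by simp
  have abs: "(\<lambda>y. ennreal \<bar>\<omega> y\<bar>) = (\<lambda>y. ennreal (\<omega> y))"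
    using \<omega> by (auto simp: weight_def)
  have "A1_loc_const \<rho> \<omega> \<le> ennreal C \<longleftrightarrow> (\<forall>Q\<in>cubes_upto \<rho>.
      AE x in lebesgue. x \<in> Q \<longrightarrow> average Q (\<lambda>y. ennreal (\<omega> y)) \<le> ennreal (C * \<omega> x))"
    unfolding A1_loc_const_def SUP_le_iff
    by (intro ball_cong refl average_times_Linfty_norm_inverse_le_iff \<omega> sets C)
  also have "\<dots> \<longleftrightarrow> (AE x in lebesgue. maximal_loc \<rho> \<omega> x \<le> ennreal (C * \<omega> x))"
    unfolding maximal_loc_def abs
  proof
    assume "\<forall>Q\<in>cubes_upto \<rho>.
      AE x in lebesgue. x \<in> Q \<longrightarrow> average Q (\<lambda>y. ennreal (\<omega> y)) \<le> ennreal (C * \<omega> x)"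
    then show "AE x in lebesgue. (SUP Q\<in>{Q \<in> cubes_upto \<rho>. x \<in> Q}. average Q (\<lambda>y. ennreal (\<omega> y)))
        \<le> ennreal (C * \<omega> x)"
      by (intro AE_SUP_open_cover_le open_cubes_upto) auto
  next
    assume AE: "AE x in lebesgue.
        (SUP Q\<in>{Q \<in> cubes_upto \<rho>. x \<in> Q}. average Q (\<lambda>y. ennreal (\<omega> y))) \<le> ennreal (C * \<omega> x)"
    show "\<forall>Q\<in>cubes_upto \<rho>.
      AE x in lebesgue. x \<in> Q \<longrightarrow> average Q (\<lambda>y. ennreal (\<omega> y)) \<le> ennreal (C * \<omega> x)"
      using AE by (auto simp: SUP_le_iff elim!: eventually_mono)
  qed
  finally show ?thesis ..
qed

text \<open>For \<open>a = 0\<close> the condition \<open>0 < C\<close> excludes the minimum, so the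
  infimum is not attained; otherwise it is.\<close>

lemma Inf_pos_upper_bounds:
  fixes a :: real
  assumes "0 \<le> a"
  shows "Inf {C. 0 < C \<and> a \<le> C} = a"
proof (cases "a = 0")
  case True
  then have "{C. 0 < C \<and> a \<le> C} = {0<..}" by auto
  then show ?thesis using True by simp
next
  case False
  then have "{C. 0 < C \<and> a \<le> C} = {a..}" using assms by auto
  then show ?thesis by simp
qed

theorem proposition2p3p2:
  fixes \<omega> :: "real ^ 'n \<Rightarrow> real" and \<rho> :: real
  assumes "0 < \<rho>" and "weight \<omega>"
  shows "(\<omega> \<in> A1_loc \<rho> \<longleftrightarrow>
           (\<exists>C::real. 0 < C \<and> (AE x in lebesgue. maximal_loc \<rho> \<omega> x \<le> ennreal (C * \<omega> x)))) \<and>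
         (\<omega> \<in> A1_loc \<rho> \<longrightarrow>
           ennreal (Inf {C::real. 0 < C \<and> (AE x in lebesgue. maximal_loc \<rho> \<omega> x \<le> ennreal (C * \<omega> x))})
             = A1_loc_const \<rho> \<omega>)"
proof -
  let ?A = "A1_loc_const \<rho> \<omega>"
  \<comment> \<open>Keeping \<open>0 < C\<close> on both sides makes this an unconditional rewrite
    of the set of admissible constants.\<close>
  have iff: "0 < C \<and> (AE x in lebesgue. maximal_loc \<rho> \<omega> x \<le> ennreal (C * \<omega> x))
      \<longleftrightarrow> 0 < C \<and> ?A \<le> ennreal C" for C
    using AE_maximal_loc_le_iff[OF assms(2)] by blast
  have mem: "\<omega> \<in> A1_loc \<rho> \<longleftrightarrow> ?A < \<infinity>"
    using assms(2) by (simp add: A1_loc_def)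
  show ?thesis
    unfolding iff mem
  proof (cases ?A)
    case (real a)
    have "\<exists>C>0. a \<le> C" by (rule exI[of _ "\<bar>a\<bar> + 1"]) auto
    moreover have "{C. 0 < C \<and> ennreal a \<le> ennreal C} = {C. 0 < C \<and> a \<le> C}"
      by (auto simp: ennreal_le_iff)
    ultimately show "(?A < \<infinity> \<longleftrightarrow> (\<exists>C>0. ?A \<le> ennreal C)) \<and>
        (?A < \<infinity> \<longrightarrow> ennreal (Inf {C. 0 < C \<and> ?A \<le> ennreal C}) = ?A)"
      using real Inf_pos_upper_bounds[of a] by (auto simp: ennreal_le_iff)
  next
    \<comment> \<open>No real \<open>C\<close> dominates \<open>top\<close>, so both sides of the
      equivalence fail and the second claim is vacuous.\<close>
    case top
    then show "(?A < \<infinity> \<longleftrightarrow> (\<exists>C>0. ?A \<le> ennreal C)) \<and>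
        (?A < \<infinity> \<longrightarrow> ennreal (Inf {C. 0 < C \<and> ?A \<le> ennreal C}) = ?A)"
      by (simp add: top_unique)
  qed
qed

end
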